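(* Let $X$ be the design matrix of an SBBD$^*(v_1,v_2,N;\Lambda)$, $\Lambda=(\mu,\lambda_{12},\lambda_{21},\lambda_{22})$, and suppose that all basic contrasts of $\boldsymbol{\tau}$ are estimable. Then the design is variance balanced.
   Context: Designs. Let $v_1,v_2,N$ be positive integers, $V_1,V_2$ disjoint sets with $|V_1|=v_1$, $|V_2|=v_2$ (identified with $\{1,\dots,v_1\}$ and $\{1,\dots,v_2\}$), and let $K_{v_1,v_2}=(V_1,V_2;E)$ be the complete bipartite graph, with edges $e_{ij}$ ($i\in V_1$, $j\in V_2$). An SBBD$^*(v_1,v_2,N;\Lambda)$ with $\Lambda=(\mu,\lambda_{12},\lambda_{21},\lambda_{22})$ is a pair $(K_{v_1,v_2};\mathcal{B})$, where $\mathcal{B}=\{B_1,\dots,B_N\}$ is a collection (repetitions allowed) of subgraphs of $K_{v_1,v_2}$, identified with their edge sets, such that: (ii) each edge of $E$ belongs to exactly $\mu$ of the $B_k$; (iii) any two edges $e_{ij},e_{ij'}$ with $j\neq j'$ are contained together in exactly $\lambda_{12}$ of the $B_k$; (iv) any two edges $e_{ij},e_{i'j}$ with $i\ne i'$ are contained together in exactly $\lambda_{21}$ of the $B_k$; (v) any two edges $e_{ij},e_{i'j'}$ with $i\neq i'$, $j\ne j'$ are contained together in exactly $\lambda_{22}$ of the $B_k$. (No condition that the $B_k$ be spanning is imposed.) The design matrix $X$ is the $N\times v_1v_2$ $(0,1)$-matrix with columns indexed by the edges in the lexicographical order $(e_{11},\dots,e_{1v_2};e_{21},\dots,e_{2v_2};\dots;e_{v_11},\dots,e_{v_1v_2})$,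 whose entry in row $k$ and the column of $e_{ij}$ is $1$ if $e_{ij}\in B_k$ and $0$ otherwise. Model. $\mathbf{y}=X\boldsymbol{\tau}+\boldsymbol{\epsilon}$, where $\boldsymbol{\tau}=(\tau_{ij})$ is the unknown real vector of effects of length $v_1v_2$ in the same lexicographical order, subject to $\sum_{j}\tau_{ij}=0$ for all $i$ and $\sum_i\tau_{ij}=0$ for all $j$, and $\boldsymbol{\epsilon}$ is a vector of independent $N(0,\sigma^2)$ errors. A linear function $\mathbf{c}^t\boldsymbol{\tau}$ is estimable if there is a vector $\mathbf{a}$ such that the expectation of $\mathbf{a}^t\mathbf{y}$ equals $\mathbf{c}^t\boldsymbol{\tau}$ for all admissible $\boldsymbol{\tau}$. Basic contrasts. The information matrix $X^tX$ of an SBBD$^*$ has the form $I_{v_1}\otimes A'+(J_{v_1}-I_{v_1})\otimes B'$, with $A',B'$ both linear combinations of $I_{v_2}$ and the all-ones matrix $J_{v_2}$. Let $\boldsymbol{p}_1,\dots,\boldsymbol{p}_{v_1-1}$ be orthonormal vectors in $\mathbb{R}^{v_1}$ orthogonal to the all-ones vector $\boldsymbol{1}_{v_1}$, and $\boldsymbol{q}_1,\dots,\boldsymbol{q}_{v_2-1}$ orthonormal vectors in $\mathbb{R}^{v_2}$ orthogonal to $\boldsymbol{1}_{v_2}$ (these are eigenvectors of every matrix of the form $xI+yJ$ of the corresponding size). The basic contrasts are $(\boldsymbol{p}_i\otimes\boldsymbol{q}_j)^t\boldsymbol{\tau}$, $1\le i\le v_1-1$, $1\le j\le v_2-1$. Variance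 balanced. The variance of the estimator of a basic contrast is $\mathrm{Var}((\boldsymbol{p}_i\otimes\boldsymbol{q}_j)^t\hat{\boldsymbol{\tau}})=(\boldsymbol{p}_i\otimes\boldsymbol{q}_j)^t(X^tX)^-(\boldsymbol{p}_i\otimes\boldsymbol{q}_j)\sigma^2$, where $(X^tX)^-$ is the Moore-Penrose generalized inverse. The design is variance balanced if all these variances are the same, that is, if $X^tX$ has $(v_1-1)(v_2-1)$ identical non-zero eigenvalues (counted with multiplicity, belonging to the vectors $\boldsymbol{p}_i\otimes\boldsymbol{q}_j$), say $\alpha$, so that $\mathrm{Var}((\boldsymbol{p}_i\otimes\boldsymbol{q}_j)^t\hat{\boldsymbol{\tau}})=\frac{1}{\alpha}\sigma^2$ for all $1\le i\le v_1-1$, $1\le j\le v_2-1$. *)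

theory Defs
  imports "HOL-Probability.Probability" "Jordan_Normal_Form.Char_Poly"
begin

unbundle no vec_syntax
unbundle no inner_syntax

(* The points of V_1 and V_2 are numbered from 0: V_1 = {..<v1}, V_2 = {..<v2}.  The edge joining
   i in V_1 to j in V_2 is the pair (i, j).  The collection of blocks is a family indexed by
   {..<N}, so that repeated blocks are counted with repetition. *)
definition sbbd_star ::
  "nat \<Rightarrow> nat \<Rightarrow> nat \<Rightarrow> nat \<Rightarrow> nat \<Rightarrow> nat \<Rightarrow> nat \<Rightarrow> (nat \<Rightarrow> (nat \<times> nat) set) \<Rightarrow> bool"
where
  "sbbd_star v1 v2 N \<mu> lam12 lam21 lam22 B \<longleftrightarrow>
     0 < v1 \<and> 0 < v2 \<and> 0 < N \<and>
     (\<forall>k<N. B k \<subseteq> {..<v1} \<times> {..<v2}) \<and>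
     (\<forall>i<v1. \<forall>j<v2. card {k. k < N \<and> (i, j) \<in> B k} = \<mu>) \<and>
     (\<forall>i<v1. \<forall>j<v2. \<forall>j'<v2. j \<noteq> j' \<longrightarrow>
        card {k. k < N \<and> (i, j) \<in> B k \<and> (i, j') \<in> B k} = lam12) \<and>
     (\<forall>i<v1. \<forall>i'<v1. \<forall>j<v2. i \<noteq> i' \<longrightarrow>
        card {k. k < N \<and> (i, j) \<in> B k \<and> (i', j) \<in> B k} = lam21) \<and>
     (\<forall>i<v1. \<forall>i'<v1. \<forall>j<v2. \<forall>j'<v2. i \<noteq> i' \<and> j \<noteq> j' \<longrightarrow>
        card {k. k < N \<and> (i, j) \<in> B k \<and> (i', j') \<in> B k} = lam22)"

(* In the lexicographical order of the edges, (i, j) has position i * v2 + j; conversely the edge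
   at position c is (c div v2, c mod v2). *)
definition design_matrix ::
  "nat \<Rightarrow> nat \<Rightarrow> nat \<Rightarrow> (nat \<Rightarrow> (nat \<times> nat) set) \<Rightarrow> real mat"
where
  "design_matrix v1 v2 N B =
     Matrix.mat N (v1 * v2) (\<lambda>(k, c). if (c div v2, c mod v2) \<in> B k then 1 else 0)"

definition information_matrix :: "real mat \<Rightarrow> real mat" where
  "information_matrix X = transpose_mat X * X"

definition kron_vec :: "real vec \<Rightarrow> real vec \<Rightarrow> real vec" (infixl "\<otimes>\<^sub>v" 70) where
  "p \<otimes>\<^sub>v q =
     Matrix.vec (dim_vec p * dim_vec q) (\<lambda>c. p $ (c div dim_vec q) * q $ (c mod dim_vec q))"

definition admissible_effects :: "nat \<Rightarrow> nat \<Rightarrow> real vec set" where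
  "admissible_effects v1 v2 =
     {\<tau> \<in> carrier_vec (v1 * v2).
        (\<forall>i<v1. (\<Sum>j<v2. \<tau> $ (i * v2 + j)) = 0) \<and>
        (\<forall>j<v2. (\<Sum>i<v1. \<tau> $ (i * v2 + j)) = 0)}"

(* N(0, \<sigma>^2) has standard deviation \<sigma>, which is the second argument of normal_density. *)
definition normal_errors :: "'w measure \<Rightarrow> nat \<Rightarrow> real \<Rightarrow> (nat \<Rightarrow> 'w \<Rightarrow> real) \<Rightarrow> bool" where
  "normal_errors M N \<sigma> \<epsilon> \<longleftrightarrow>
     prob_space M \<and> 0 < \<sigma> \<and>
     prob_space.indep_vars M (\<lambda>_. borel) \<epsilon> {..<N} \<and>
     (\<forall>k<N. distributed M lborel (\<epsilon> k) (\<lambda>x. ennreal (normal_density 0 \<sigma> x)))"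

definition response :: "real mat \<Rightarrow> (nat \<Rightarrow> 'w \<Rightarrow> real) \<Rightarrow> real vec \<Rightarrow> 'w \<Rightarrow> real vec" where
  "response X \<epsilon> \<tau> \<omega> = X *\<^sub>v \<tau> + Matrix.vec (dim_row X) (\<lambda>k. \<epsilon> k \<omega>)"

definition estimable ::
  "'w measure \<Rightarrow> nat \<Rightarrow> nat \<Rightarrow> real mat \<Rightarrow> (nat \<Rightarrow> 'w \<Rightarrow> real) \<Rightarrow> real vec \<Rightarrow> bool"
where
  "estimable M v1 v2 X \<epsilon> c \<longleftrightarrow>
     (\<exists>a \<in> carrier_vec (dim_row X). \<forall>\<tau> \<in> admissible_effects v1 v2.
        prob_space.expectation M (\<lambda>\<omega>. a \<bullet> response X \<epsilon> \<tau> \<omega>) = c \<bullet> \<tau>)"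

(* p 0, ..., p (n - 2) are n - 1 orthonormal vectors orthogonal to the all-ones vector. *)
definition orthonormal_contrasts :: "nat \<Rightarrow> (nat \<Rightarrow> real vec) \<Rightarrow> bool" where
  "orthonormal_contrasts n p \<longleftrightarrow>
     (\<forall>i<n - 1. p i \<in> carrier_vec n \<and> p i \<bullet> Matrix.vec n (\<lambda>_. 1) = 0) \<and>
     (\<forall>i<n - 1. \<forall>i'<n - 1. p i \<bullet> p i' = (if i = i' then 1 else 0))"

(* The four Penrose equations, which determine G uniquely. *)
definition is_moore_penrose :: "real mat \<Rightarrow> real mat \<Rightarrow> bool" where
  "is_moore_penrose A G \<longleftrightarrow>
     G \<in> carrier_mat (dim_col A) (dim_row A) \<and>
     A * G * A = A \<and> G * A * G = G \<and>
     transpose_mat (A * G) = A * G \<and> transpose_mat (G * A) = G * A"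

definition moore_penrose :: "real mat \<Rightarrow> real mat" where
  "moore_penrose A = (THE G. is_moore_penrose A G)"

(* The least squares estimator of \<tau>, as a function of the observed response y. *)
definition effects_estimator :: "real mat \<Rightarrow> real vec \<Rightarrow> real vec" where
  "effects_estimator X y = moore_penrose (information_matrix X) *\<^sub>v (transpose_mat X *\<^sub>v y)"

(* The p i \<otimes>\<^sub>v q j are orthonormal, so the first conjunct says that \<alpha> is an eigenvalue of the
   information matrix (v1 - 1) * (v2 - 1) times, counted with multiplicity.  The other two
   evaluate the variance of the estimator of the basic contrast, first as given by the quadratic
   form of the generalized inverse, then as the variance of a random variable in the model. *)
definition variance_balanced ::
  "'w measure \<Rightarrow> nat \<Rightarrow> nat \<Rightarrow> real mat \<Rightarrow> real \<Rightarrow> (nat \<Rightarrow> 'w \<Rightarrow> real) \<Rightarrow>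
   (nat \<Rightarrow> real vec) \<Rightarrow> (nat \<Rightarrow> real vec) \<Rightarrow> bool"
where
  "variance_balanced M v1 v2 X \<sigma> \<epsilon> p q \<longleftrightarrow>
     (\<exists>\<alpha>. \<alpha> \<noteq> 0 \<and> (\<forall>i<v1 - 1. \<forall>j<v2 - 1.
        eigenvector (information_matrix X) (p i \<otimes>\<^sub>v q j) \<alpha> \<and>
        (p i \<otimes>\<^sub>v q j) \<bullet> (moore_penrose (information_matrix X) *\<^sub>v (p i \<otimes>\<^sub>v q j)) * \<sigma>\<^sup>2
          = 1 / \<alpha> * \<sigma>\<^sup>2 \<and>
        (\<forall>\<tau> \<in> admissible_effects v1 v2.
           prob_space.variance M
             (\<lambda>\<omega>. (p i \<otimes>\<^sub>v q j) \<bullet> effects_estimator X (response X \<epsilon> \<tau> \<omega>)) = 1 / \<alpha> * \<sigma>\<^sup>2)))"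

end

theory Submission
  imports Defs
begin

text \<open>
  Averaging over \<open>V\<^sub>1\<close> and over \<open>V\<^sub>2\<close> gives commuting orthogonal projections, and the information matrix
  is a linear combination of the four products of these projections with their complements. Its
  Moore-Penrose inverse is obtained by inverting the nonzero coefficients. Every basic contrast lies in
  the range of the same projection (the one that is centered in both coordinates), whose coefficient is
  \<open>\<alpha> = \<mu> - \<lambda>\<^sub>1\<^sub>2 - \<lambda>\<^sub>2\<^sub>1 + \<lambda>\<^sub>2\<^sub>2\<close>. If \<open>\<alpha>\<close> were zero, the design matrix would annihilate the basic contrasts, so
  that the response would not distinguish the effects \<open>w = p\<^sub>i \<otimes> q\<^sub>j\<close> from zero effects, although \<open>w\<^sup>t w = 1\<close>.
\<close>

section \<open>Lexicographic positions and Kronecker products of vectors\<close>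

lemma mult_add_less_mult:
  fixes i j m n :: nat
  assumes "i < m" "j < n"
  shows "i * n + j < m * n"
proof -
  have "i * n + j < Suc i * n" using assms by simp
  also have "\<dots> \<le> m * n" using assms by (intro mult_right_mono) auto
  finally show ?thesis .
qed

text \<open>Lexicographic numbering is a bijection onto the index pairs; for \<open>n = 0\<close>
  both sums vanish. Later proofs rewrite the summand as an explicit binary function applied to
  \<open>c div n\<close> and \<open>c mod n\<close>, so that this rule matches and the sum
  factors.\<close>

lemma sum_div_mod:
  fixes f :: "nat \<Rightarrow> nat \<Rightarrow> 'a::comm_monoid_add"
  shows "(\<Sum>c<m * n. f (c div n) (c mod n)) = (\<Sum>i<m. \<Sum>j<n. f i j)"
proof (cases "n = 0")
  case False
  have "(\<Sum>c<m * n. f (c div n) (c mod n)) = (\<Sum>(i, j)\<in>{..<m} \<times> {..<n}. f i j)"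
    by (rule sum.reindex_bij_witness[of _ "\<lambda>(i, j). i * n + j" "\<lambda>c. (c div n, c mod n)"])
      (use False mult_add_less_mult in \<open>auto simp: less_mult_imp_div_less\<close>)
  then show ?thesis by (simp add: sum.cartesian_product)
qed simp

lemma scalar_prod_kron_vec:
  assumes "p \<in> carrier_vec m" "p' \<in> carrier_vec m" "q \<in> carrier_vec n" "q' \<in> carrier_vec n"
  shows "(p \<otimes>\<^sub>v q) \<bullet> (p' \<otimes>\<^sub>v q') = (p \<bullet> p') * (q \<bullet> q')"
proof -
  have "(p \<otimes>\<^sub>v q) \<bullet> (p' \<otimes>\<^sub>v q')
      = (\<Sum>c<m * n. (\<lambda>i j. (p $ i * p' $ i) * (q $ j * q' $ j)) (c div n) (c mod n))"
    using assms unfolding scalar_prod_def kron_vec_def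
    by (auto simp: atLeast0LessThan intro!: sum.cong)
  also have "\<dots> = (p \<bullet> p') * (q \<bullet> q')"
    using assms by (subst sum_div_mod) (simp add: scalar_prod_def sum_product atLeast0LessThan)
  finally show ?thesis .
qed

lemma scalar_prod_self_eq_0_iff:
  fixes v :: "real vec"
  shows "v \<bullet> v = 0 \<longleftrightarrow> v = 0\<^sub>v (dim_vec v)"
proof
  show "v = 0\<^sub>v (dim_vec v)" if "v \<bullet> v = 0"
    using that by (intro eq_vecI) (auto simp: scalar_prod_def sum_nonneg_eq_0_iff)
  show "v \<bullet> v = 0" if "v = 0\<^sub>v (dim_vec v)"
    by (subst that) simp
qed

section \<open>The four averaging projections and their algebra\<close>

text \<open>Entries of \<open>I - J / n\<close> (flag \<open>True\<close>) and of
  \<open>J / n\<close> (flag \<open>False\<close>), the projections onto the vectors with sum zero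
  and onto the constant vectors.\<close>

definition mean_proj :: "nat \<Rightarrow> bool \<Rightarrow> nat \<Rightarrow> nat \<Rightarrow> real" where
  "mean_proj n centered i j =
     (if centered then (if i = j then 1 else 0) - 1 / real n else 1 / real n)"

text \<open>Since J^2 = n J, the matrix \<open>J / n\<close> is idempotent, and hence so is its
  complement, with product zero between them.\<close>

lemma mean_proj_mult:
  assumes "i < n" "j < n"
  shows "(\<Sum>k<n. mean_proj n b i k * mean_proj n b' k j) = (if b = b' then mean_proj n b i j else 0)"
proof -
  have "real n > 0" using assms by simp
  then show ?thesis
    using assms
    by (cases b; cases b')
      (auto simp: mean_proj_def algebra_simps sum.distrib sum_subtractf sum.delta' sum.delta
        if_distrib[of "\<lambda>x. x * _"] if_distrib[of "\<lambda>x. _ * x"] if_distrib[of "\<lambda>x. x / _"] cong: if_cong)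
qed

lemma mean_proj_sym: "mean_proj n b i j = mean_proj n b j i"
  by (simp add: mean_proj_def)

text \<open>\<open>J / n\<close> kills a vector with sum zero, so its complement fixes it.\<close>

lemma mean_proj_contrast:
  assumes "i < n" "(\<Sum>k<n. f k) = 0"
  shows "(\<Sum>k<n. mean_proj n b i k * f k) = (if b then f i else 0)"
proof -
  have "(\<Sum>k<n. f k / real n) = 0" using assms(2) by (simp flip: sum_divide_distrib)
  then show ?thesis
    using assms(1)
    by (auto simp: mean_proj_def left_diff_distrib sum_subtractf sum.delta
        if_distrib[of "\<lambda>x. x * _"] cong: if_cong)
qed

text \<open>Entries of the Kronecker product of two averaging projections; the pair of flags selects
  one of the four products.\<close>

definition biproj :: "nat \<Rightarrow> nat \<Rightarrow> bool \<times> bool \<Rightarrow> nat \<Rightarrow> nat \<Rightarrow> real" where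
  "biproj m n x c d =
     mean_proj m (fst x) (c div n) (d div n) * mean_proj n (snd x) (c mod n) (d mod n)"

lemma div_mod_less_mult:
  fixes c :: nat
  assumes "c < m * n"
  shows "c div n < m" "c mod n < n"
proof -
  have "n \<noteq> 0" using assms by (intro notI) simp
  then show "c div n < m" "c mod n < n" using assms by (auto simp: less_mult_imp_div_less)
qed

text \<open>The sum over positions factors into one sum per coordinate, so the four products inherit
  idempotence and mutual orthogonality from their factors.\<close>

lemma biproj_mult:
  assumes "c < m * n" "d < m * n"
  shows "(\<Sum>e<m * n. biproj m n x c e * biproj m n y e d) = (if x = y then biproj m n x c d else 0)"
proof -
  have "(\<Sum>e<m * n. biproj m n x c e * biproj m n y e d)
      = (\<Sum>e<m * n. (\<lambda>i j.
          (mean_proj m (fst x) (c div n) i * mean_proj m (fst y) i (d div n)) *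
          (mean_proj n (snd x) (c mod n) j * mean_proj n (snd y) j (d mod n))) (e div n) (e mod n))"
    by (simp add: biproj_def mult_ac)
  also have "\<dots> =
      (\<Sum>i<m. mean_proj m (fst x) (c div n) i * mean_proj m (fst y) i (d div n)) *
      (\<Sum>j<n. mean_proj n (snd x) (c mod n) j * mean_proj n (snd y) j (d mod n))"
    by (subst sum_div_mod) (simp add: sum_product)
  finally show ?thesis
    using div_mod_less_mult[OF assms(1)] div_mod_less_mult[OF assms(2)]
    by (simp add: mean_proj_mult biproj_def prod_eq_iff)
qed

text \<open>Matrices are represented by their four eigenvalues, which turns matrix multiplication
  and generalized inversion into pointwise operations on \<open>\<theta>\<close>.\<close>

definition biproj_mat :: "nat \<Rightarrow> nat \<Rightarrow> (bool \<times> bool \<Rightarrow> real) \<Rightarrow> real mat" where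
  "biproj_mat m n \<theta> = Matrix.mat (m * n) (m * n) (\<lambda>(c, d). \<Sum>x\<in>UNIV. \<theta> x * biproj m n x c d)"

lemma biproj_mat_carrier [simp]: "biproj_mat m n \<theta> \<in> carrier_mat (m * n) (m * n)"
  by (simp add: biproj_mat_def)

lemma transpose_biproj_mat [simp]: "transpose_mat (biproj_mat m n \<theta>) = biproj_mat m n \<theta>"
  by (rule eq_matI) (auto simp: biproj_mat_def biproj_def mean_proj_sym intro!: sum.cong)

lemma biproj_mat_mult:
  "biproj_mat m n \<theta> * biproj_mat m n \<phi> = biproj_mat m n (\<lambda>x. \<theta> x * \<phi> x)"
proof (rule eq_matI)
  fix c d assume "c < dim_row (biproj_mat m n (\<lambda>x. \<theta> x * \<phi> x))"
    "d < dim_col (biproj_mat m n (\<lambda>x. \<theta> x * \<phi> x))"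
  then have cd: "c < m * n" "d < m * n" by (simp_all add: biproj_mat_def)
  have "(biproj_mat m n \<theta> * biproj_mat m n \<phi>) $$ (c, d)
      = (\<Sum>e<m * n. (\<Sum>x\<in>UNIV. \<theta> x * biproj m n x c e) * (\<Sum>y\<in>UNIV. \<phi> y * biproj m n y e d))"
    using cd by (simp add: biproj_mat_def scalar_prod_def atLeast0LessThan)
  also have "\<dots> = (\<Sum>e<m * n. \<Sum>x\<in>UNIV. \<Sum>y\<in>UNIV.
      \<theta> x * \<phi> y * (biproj m n x c e * biproj m n y e d))"
    unfolding sum_product by (intro sum.cong refl) (simp only: mult_ac)
  \<comment> \<open>With the sum over \<open>e\<close> innermost, orthogonality of the projections
    removes all terms with \<open>x \<noteq> y\<close>.\<close>
  also have "\<dots> = (\<Sum>x\<in>UNIV. \<Sum>y\<in>UNIV. \<Sum>e<m * n.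
      \<theta> x * \<phi> y * (biproj m n x c e * biproj m n y e d))"
    by (subst sum.swap, rule sum.cong[OF refl], rule sum.swap)
  also have "\<dots> = (\<Sum>x\<in>UNIV. \<theta> x * \<phi> x * biproj m n x c d)"
    using cd by (simp add: biproj_mult sum.delta if_distrib[of "\<lambda>z. _ * z"] cong: if_cong
        flip: sum_distrib_left)
  finally show "(biproj_mat m n \<theta> * biproj_mat m n \<phi>) $$ (c, d)
      = biproj_mat m n (\<lambda>x. \<theta> x * \<phi> x) $$ (c, d)"
    using cd by (simp add: biproj_mat_def)
qed (auto simp: biproj_mat_def)

text \<open>Both factors have sum zero, so three of the four projections annihilate the product and
  the doubly centered one fixes it.\<close>

lemma biproj_mat_kron_vec:
  assumes p: "p \<in> carrier_vec m" "p \<bullet> Matrix.vec m (\<lambda>_. 1) = 0"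
    and q: "q \<in> carrier_vec n" "q \<bullet> Matrix.vec n (\<lambda>_. 1) = 0"
  shows "biproj_mat m n \<theta> *\<^sub>v (p \<otimes>\<^sub>v q) = \<theta> (True, True) \<cdot>\<^sub>v (p \<otimes>\<^sub>v q)"
proof (rule eq_vecI)
  fix c assume "c < dim_vec (\<theta> (True, True) \<cdot>\<^sub>v (p \<otimes>\<^sub>v q))"
  then have c: "c < m * n" using p q by (simp add: kron_vec_def)
  have p0: "(\<Sum>i<m. p $ i) = 0" and q0: "(\<Sum>j<n. q $ j) = 0"
    using p q by (simp_all add: scalar_prod_def atLeast0LessThan)
  have proj: "(\<Sum>e<m * n. biproj m n x c e * (p $ (e div n) * q $ (e mod n)))
      = (if x = (True, True) then p $ (c div n) * q $ (c mod n) else 0)" for x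
  proof -
    have "(\<Sum>e<m * n. biproj m n x c e * (p $ (e div n) * q $ (e mod n)))
      = (\<Sum>e<m * n. (\<lambda>i j. (mean_proj m (fst x) (c div n) i * p $ i) *
          (mean_proj n (snd x) (c mod n) j * q $ j)) (e div n) (e mod n))"
      by (simp add: biproj_def mult_ac)
    also have "\<dots> = (\<Sum>i<m. mean_proj m (fst x) (c div n) i * p $ i) *
        (\<Sum>j<n. mean_proj n (snd x) (c mod n) j * q $ j)"
      by (subst sum_div_mod) (simp add: sum_product)
    finally show ?thesis
      using div_mod_less_mult[OF c] p0 q0 by (simp add: mean_proj_contrast prod_eq_iff)
  qed
  have "(biproj_mat m n \<theta> *\<^sub>v (p \<otimes>\<^sub>v q)) $ c
      = (\<Sum>e<m * n. (\<Sum>x\<in>UNIV. \<theta> x * biproj m n x c e) * (p $ (e div n) * q $ (e mod n)))"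
    using c p q by (simp add: biproj_mat_def kron_vec_def scalar_prod_def atLeast0LessThan)
  also have "\<dots> = (\<Sum>x\<in>UNIV. \<theta> x *
      (\<Sum>e<m * n. biproj m n x c e * (p $ (e div n) * q $ (e mod n))))"
    unfolding sum_distrib_right sum_distrib_left by (subst sum.swap) (simp add: mult_ac)
  also have "\<dots> = \<theta> (True, True) * (p $ (c div n) * q $ (c mod n))"
    by (simp add: proj if_distrib[of "\<lambda>z. _ * z"] sum.delta cong: if_cong)
  finally show "(biproj_mat m n \<theta> *\<^sub>v (p \<otimes>\<^sub>v q)) $ c = (\<theta> (True, True) \<cdot>\<^sub>v (p \<otimes>\<^sub>v q)) $ c"
    using c p q by (simp add: kron_vec_def)
qed (use p q in \<open>simp add: biproj_mat_def kron_vec_def\<close>)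

section \<open>Moore-Penrose inverses\<close>

text \<open>Justifies the definite description in \<open>moore_penrose\<close>. Symmetry lets
  transposition swap the factors of \<open>(A * H) * (A * G)\<close>, which collapses to
  \<open>A * G\<close> in one order and to \<open>A * H\<close> in the other; likewise for
  \<open>G * A\<close> and \<open>H * A\<close>.\<close>

lemma is_moore_penrose_unique:
  assumes "is_moore_penrose A G" "is_moore_penrose A H"
  shows "G = H"
proof -
  let ?r = "dim_row A" and ?c = "dim_col A"
  have A: "A \<in> carrier_mat ?r ?c" by simp
  have G: "G \<in> carrier_mat ?c ?r" and H: "H \<in> carrier_mat ?c ?r"
    using assms by (auto simp: is_moore_penrose_def)
  have GA: "G * A \<in> carrier_mat ?c ?c" and HA: "H * A \<in> carrier_mat ?c ?c"
    and AG: "A * G \<in> carrier_mat ?r ?r" and AH: "A * H \<in> carrier_mat ?r ?r"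
    using A G H by auto
  have g: "A * G * A = A" "G * A * G = G"
      "transpose_mat (A * G) = A * G" "transpose_mat (G * A) = G * A"
    and h: "A * H * A = A" "H * A * H = H"
      "transpose_mat (A * H) = A * H" "transpose_mat (H * A) = H * A"
    using assms by (auto simp: is_moore_penrose_def)
  have "A * G = transpose_mat ((A * H) * (A * G))"
    using assoc_mult_mat[OF AH A G] by (simp add: g h)
  also have "\<dots> = (A * G) * (A * H)"
    using transpose_mult[OF AH AG] by (simp add: g h)
  also have "\<dots> = A * H"
    using assoc_mult_mat[OF AG A H] by (simp add: g h)
  finally have AGH: "A * G = A * H" .
  have "G * A = transpose_mat ((G * A) * (H * A))"
    using assoc_mult_mat[OF G A HA] assoc_mult_mat[OF A H A] by (simp add: g h)
  also have "\<dots> = (H * A) * (G * A)"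
    using transpose_mult[OF GA HA] by (simp add: g h)
  also have "\<dots> = H * A"
    using assoc_mult_mat[OF H A GA] assoc_mult_mat[OF A G A] by (simp add: g h)
  finally have GAH: "G * A = H * A" .
  \<comment> \<open>The two equalities give G = GAG = HAG = HAH = H.\<close>
  have "G = H * A * G" using g(2) GAH by simp
  also have "\<dots> = H * (A * H)" using assoc_mult_mat[OF H A G] AGH by simp
  also have "\<dots> = H" using assoc_mult_mat[OF H A H] h(2) by simp
  finally show ?thesis .
qed

text \<open>The convention \<open>inverse 0 = 0\<close> makes the pointwise inverse satisfy the
  Penrose equations at vanishing eigenvalues too; all products involved are symmetric.\<close>

lemma moore_penrose_biproj_mat:
  "moore_penrose (biproj_mat m n \<theta>) = biproj_mat m n (\<lambda>x. inverse (\<theta> x))"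
proof -
  have inv: "t * inverse t * t = t" "inverse t * t * inverse t = inverse t" for t :: real
    by (cases "t = 0"; simp)+
  have "dim_row (biproj_mat m n \<theta>) = m * n" "dim_col (biproj_mat m n \<theta>) = m * n"
    by (simp_all add: biproj_mat_def)
  then have "is_moore_penrose (biproj_mat m n \<theta>) (biproj_mat m n (\<lambda>x. inverse (\<theta> x)))"
    by (simp add: is_moore_penrose_def biproj_mat_mult inv)
  then show ?thesis
    unfolding moore_penrose_def by (blast intro: the_equality is_moore_penrose_unique)
qed

section \<open>Spectral decomposition of the information matrix\<close>

text \<open>The information matrix is a combination of the Kronecker products of I and J, with
  coefficients \<open>\<mu> - l12 - l21 + l22\<close> for I, I; \<open>l12 - l22\<close> for I, J;
  \<open>l21 - l22\<close> for J, I; and \<open>l22\<close> for J, J. On a centered coordinate J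
  acts as 0, on an averaged one as the size of that coordinate.\<close>

definition sbbd_eigenvalue ::
  "nat \<Rightarrow> nat \<Rightarrow> real \<Rightarrow> real \<Rightarrow> real \<Rightarrow> real \<Rightarrow> bool \<times> bool \<Rightarrow> real"
where
  "sbbd_eigenvalue v1 v2 \<mu> l12 l21 l22 x =
     (\<mu> - l12 - l21 + l22)
     + (if snd x then 0 else v2 * (l12 - l22))
     + (if fst x then 0 else v1 * (l21 - l22))
     + (if fst x \<or> snd x then 0 else v1 * v2 * l22)"

text \<open>Summing eigenvalue times projection recovers the entries; positive sizes allow the
  denominators to be cleared.\<close>

lemma sum_sbbd_eigenvalue_biproj:
  assumes "0 < v1" "0 < v2"
  shows "(\<Sum>x\<in>UNIV. sbbd_eigenvalue v1 v2 \<mu> l12 l21 l22 x * biproj v1 v2 x c d) =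
    (if c div v2 = d div v2
     then if c mod v2 = d mod v2 then \<mu> else l12
     else if c mod v2 = d mod v2 then l21 else l22)"
  using assms
  by (simp add: UNIV_bool UNIV_Times_UNIV[symmetric] sum.cartesian_product[symmetric]
      sbbd_eigenvalue_def biproj_def mean_proj_def del: UNIV_Times_UNIV)
    (simp add: field_simps)

text \<open>Each entry counts the blocks containing both edges, and the four counting conditions of
  the design cover the four ways in which the endpoints can agree or differ.\<close>

lemma information_matrix_sbbd_star:
  assumes "sbbd_star v1 v2 N \<mu> lam12 lam21 lam22 B"
  shows "information_matrix (design_matrix v1 v2 N B)
    = biproj_mat v1 v2 (sbbd_eigenvalue v1 v2 \<mu> lam12 lam21 lam22)"
proof (rule eq_matI)
  fix c d assume "c < dim_row (biproj_mat v1 v2 (sbbd_eigenvalue v1 v2 \<mu> lam12 lam21 lam22))"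
    "d < dim_col (biproj_mat v1 v2 (sbbd_eigenvalue v1 v2 \<mu> lam12 lam21 lam22))"
  then have cd: "c < v1 * v2" "d < v1 * v2" by (simp_all add: biproj_mat_def)
  let ?e = "\<lambda>c::nat. (c div v2, c mod v2)"
  have v: "0 < v1" "0 < v2" using assms by (simp_all add: sbbd_star_def)
  have "information_matrix (design_matrix v1 v2 N B) $$ (c, d)
      = (\<Sum>k<N. if ?e c \<in> B k \<and> ?e d \<in> B k then 1 else 0)"
    using cd unfolding information_matrix_def design_matrix_def
    by (auto simp: scalar_prod_def atLeast0LessThan intro!: sum.cong)
  also have "\<dots> = real (card {k. k < N \<and> ?e c \<in> B k \<and> ?e d \<in> B k})"
    by (simp add: sum.If_cases Int_def)
  also have "\<dots> = (if c div v2 = d div v2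
     then if c mod v2 = d mod v2 then \<mu> else lam12
     else if c mod v2 = d mod v2 then lam21 else lam22)"
    using assms div_mod_less_mult[OF cd(1)] div_mod_less_mult[OF cd(2)]
    by (auto simp: sbbd_star_def)
  finally show "information_matrix (design_matrix v1 v2 N B) $$ (c, d)
      = biproj_mat v1 v2 (sbbd_eigenvalue v1 v2 \<mu> lam12 lam21 lam22) $$ (c, d)"
    using cd v by (simp add: biproj_mat_def sum_sbbd_eigenvalue_biproj)
qed (auto simp: information_matrix_def design_matrix_def biproj_mat_def)

section \<open>Variance of affine functions of the errors\<close>

text \<open>The deviation from the mean is the linear part; expanding its square leaves only the
  diagonal, because distinct errors are uncorrelated.\<close>

lemma (in prob_space) variance_affine_uncorrelated:
  fixes \<epsilon> :: "'i \<Rightarrow> 'a \<Rightarrow> real"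
  assumes mean: "\<And>k. k \<in> K \<Longrightarrow> expectation (\<epsilon> k) = 0"
    and int: "\<And>k. k \<in> K \<Longrightarrow> integrable M (\<epsilon> k)"
    and int2: "\<And>k l. k \<in> K \<Longrightarrow> l \<in> K \<Longrightarrow> integrable M (\<lambda>\<omega>. \<epsilon> k \<omega> * \<epsilon> l \<omega>)"
    and cov: "\<And>k l. k \<in> K \<Longrightarrow> l \<in> K \<Longrightarrow>
      expectation (\<lambda>\<omega>. \<epsilon> k \<omega> * \<epsilon> l \<omega>) = (if k = l then s else 0)"
    and fin: "finite K"
  shows "variance (\<lambda>\<omega>. a + (\<Sum>k\<in>K. b k * \<epsilon> k \<omega>)) = (\<Sum>k\<in>K. b k * b k) * s"
proof -
  have E: "expectation (\<lambda>\<omega>. a + (\<Sum>k\<in>K. b k * \<epsilon> k \<omega>)) = a"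
    using mean int by (simp add: prob_space)
  have "variance (\<lambda>\<omega>. a + (\<Sum>k\<in>K. b k * \<epsilon> k \<omega>))
      = expectation (\<lambda>\<omega>. \<Sum>k\<in>K. \<Sum>l\<in>K. b k * b l * (\<epsilon> k \<omega> * \<epsilon> l \<omega>))"
    unfolding E by (simp add: power2_eq_square sum_product mult_ac)
  also have "\<dots> = (\<Sum>k\<in>K. \<Sum>l\<in>K. b k * b l * expectation (\<lambda>\<omega>. \<epsilon> k \<omega> * \<epsilon> l \<omega>))"
    using int2 by (simp add: Bochner_Integration.integral_sum)
  also have "\<dots> = (\<Sum>k\<in>K. \<Sum>l\<in>K. if k = l then b k * b l * s else 0)"
    using cov by (intro sum.cong refl) simp
  finally show ?thesis using fin by (simp add: sum_distrib_right sum.delta')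
qed

lemma normal_errors_variance:
  assumes "normal_errors M N \<sigma> \<epsilon>"
  shows "prob_space.variance M (\<lambda>\<omega>. a + (\<Sum>k<N. b k * \<epsilon> k \<omega>)) = (\<Sum>k<N. b k * b k) * \<sigma>\<^sup>2"
proof -
  interpret prob_space M using assms by (simp add: normal_errors_def)
  have \<sigma>: "0 < \<sigma>" and ind: "indep_vars (\<lambda>_. borel) \<epsilon> {..<N}"
    and D: "\<And>k. k < N \<Longrightarrow> distributed M lborel (\<epsilon> k) (\<lambda>x. ennreal (normal_density 0 \<sigma> x))"
    using assms by (auto simp: normal_errors_def)
  have mean: "expectation (\<epsilon> k) = 0" if "k < N" for k
    using normal_distributed_expectation[OF \<sigma> D[OF that]] .
  have sq: "expectation (\<lambda>\<omega>. \<epsilon> k \<omega> * \<epsilon> k \<omega>) = \<sigma>\<^sup>2" if "k < N" for k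
    using normal_distributed_variance[OF \<sigma> D[OF that]] mean[OF that]
    by (simp add: power2_eq_square)
  have int: "integrable M (\<epsilon> k)" if "k < N" for k
    using distributed_integrable[OF D[OF that], of "\<lambda>x. x"] integrable_normal_moment_nz_1[OF \<sigma>, of 0]
    by simp
  have intsq: "integrable M (\<lambda>\<omega>. \<epsilon> k \<omega> * \<epsilon> k \<omega>)" if "k < N" for k
    using distributed_integrable[OF D[OF that], of "\<lambda>x. x * x"] integrable_normal_moment[OF \<sigma>, of 0 2]
    by (simp add: power2_eq_square)
  \<comment> \<open>Independence is restricted to a pair because the facts used next concern the
    product over the whole index set.\<close>
  have ind2: "indep_vars (\<lambda>_. borel) \<epsilon> {k, l}" if "k < N" "l < N" for k l
    using indep_vars_subset[OF ind] that by auto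
  have cross: "integrable M (\<lambda>\<omega>. \<epsilon> k \<omega> * \<epsilon> l \<omega>)" "expectation (\<lambda>\<omega>. \<epsilon> k \<omega> * \<epsilon> l \<omega>) = 0"
    if "k < N" "l < N" "k \<noteq> l" for k l
    using indep_vars_integrable[OF _ ind2[OF that(1,2)]]
      indep_vars_lebesgue_integral[OF _ ind2[OF that(1,2)]] that mean int by auto
  have int2: "integrable M (\<lambda>\<omega>. \<epsilon> k \<omega> * \<epsilon> l \<omega>)" if "k < N" "l < N" for k l
    using intsq cross(1) that by (cases "k = l") auto
  show ?thesis
    by (rule variance_affine_uncorrelated) (use mean sq int int2 cross(2) in auto)
qed

section \<open>Basic contrasts: nonzero eigenvalue and equal variances\<close>

theorem theorem3p3:
  fixes v1 v2 N \<mu> lam12 lam21 lam22 :: nat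
    and B :: "nat \<Rightarrow> (nat \<times> nat) set"
    and M :: "'w measure" and \<sigma> :: real and \<epsilon> :: "nat \<Rightarrow> 'w \<Rightarrow> real"
    and p q :: "nat \<Rightarrow> real vec"
  assumes "sbbd_star v1 v2 N \<mu> lam12 lam21 lam22 B"
    and "normal_errors M N \<sigma> \<epsilon>"
    and "orthonormal_contrasts v1 p"
    and "orthonormal_contrasts v2 q"
    and "\<And>i j. i < v1 - 1 \<Longrightarrow> j < v2 - 1 \<Longrightarrow>
           estimable M v1 v2 (design_matrix v1 v2 N B) \<epsilon> (p i \<otimes>\<^sub>v q j)"
  shows "variance_balanced M v1 v2 (design_matrix v1 v2 N B) \<sigma> \<epsilon> p q"
proof -
  define X where "X = design_matrix v1 v2 N B"
  define \<theta> where "\<theta> = sbbd_eigenvalue v1 v2 \<mu> lam12 lam21 lam22"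
  define \<alpha> where "\<alpha> = \<theta> (True, True)"
  define G where "G = biproj_mat v1 v2 (\<lambda>x. inverse (\<theta> x))"
  let ?n = "v1 * v2"
  have X: "X \<in> carrier_mat N ?n" by (simp add: X_def design_matrix_def)
  have A: "transpose_mat X * X = biproj_mat v1 v2 \<theta>"
    using information_matrix_sbbd_star[OF assms(1)]
    by (simp add: X_def \<theta>_def information_matrix_def)
  have MP: "moore_penrose (information_matrix X) = G"
    by (simp add: information_matrix_def A G_def moore_penrose_biproj_mat)
  have G: "G \<in> carrier_mat ?n ?n" by (simp add: G_def)
  have contrast: "w \<in> carrier_vec ?n" "w \<bullet> w = 1"
      "(transpose_mat X * X) *\<^sub>v w = \<alpha> \<cdot>\<^sub>v w" "G *\<^sub>v w = inverse \<alpha> \<cdot>\<^sub>v w"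
      "w \<in> admissible_effects v1 v2"
      "(X *\<^sub>v w) \<bullet> (X *\<^sub>v w) = \<alpha>"
    if ij: "i < v1 - 1" "j < v2 - 1" and w: "w = p i \<otimes>\<^sub>v q j" for i j w
  proof -
    have p: "p i \<in> carrier_vec v1" "p i \<bullet> Matrix.vec v1 (\<lambda>_. 1) = 0" "p i \<bullet> p i = 1"
      and q: "q j \<in> carrier_vec v2" "q j \<bullet> Matrix.vec v2 (\<lambda>_. 1) = 0" "q j \<bullet> q j = 1"
      using assms(3,4) ij by (auto simp: orthonormal_contrasts_def)
    show wc: "w \<in> carrier_vec ?n" using p q by (auto simp: w kron_vec_def)
    show ww: "w \<bullet> w = 1" using p q by (simp add: w scalar_prod_kron_vec)
    show Aw: "(transpose_mat X * X) *\<^sub>v w = \<alpha> \<cdot>\<^sub>v w"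
      using p q by (simp add: A w \<alpha>_def biproj_mat_kron_vec)
    show "G *\<^sub>v w = inverse \<alpha> \<cdot>\<^sub>v w"
      using p q by (simp add: G_def w \<alpha>_def biproj_mat_kron_vec)
    have entry: "w $ (i' * v2 + j') = p i $ i' * q j $ j'" if "i' < v1" "j' < v2" for i' j'
      using mult_add_less_mult[OF that] that p q by (simp add: w kron_vec_def)
    \<comment> \<open>Row and column sums of \<open>w\<close> each contain one of these sums as a
      factor, so \<open>w\<close> can itself serve as a vector of effects.\<close>
    have "(\<Sum>k<v1. p i $ k) = 0" "(\<Sum>k<v2. q j $ k) = 0"
      using p q by (simp_all add: scalar_prod_def atLeast0LessThan)
    then show "w \<in> admissible_effects v1 v2"
      using wc by (simp add: admissible_effects_def entry flip: sum_distrib_left sum_distrib_right)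
    have "(X *\<^sub>v w) \<bullet> (X *\<^sub>v w) = w \<bullet> (transpose_mat X *\<^sub>v (X *\<^sub>v w))"
      using X wc by (metis mult_mat_vec_carrier transpose_carrier_mat transpose_transpose
          transpose_vec_mult_scalar comm_scalar_prod)
    also have "\<dots> = \<alpha>" using X wc Aw ww by simp
    finally show "(X *\<^sub>v w) \<bullet> (X *\<^sub>v w) = \<alpha>" .
  qed
  have nonzero: "\<alpha> \<noteq> 0" if ij: "i < v1 - 1" "j < v2 - 1" for i j
  proof
    assume "\<alpha> = 0"
    define w where "w = p i \<otimes>\<^sub>v q j"
    note w = contrast[OF ij w_def]
    have "X *\<^sub>v w = 0\<^sub>v N"
      using w(6) \<open>\<alpha> = 0\<close> X by (simp add: scalar_prod_self_eq_0_iff)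
    \<comment> \<open>The responses agree for every outcome, so their expectations agree; the same
      vector \<open>a\<close> from estimability then forces
      \<open>w \<bullet> w = w \<bullet> 0\<close>, that is 1 = 0.\<close>
    then have same: "response X \<epsilon> w = response X \<epsilon> (0\<^sub>v ?n)"
      using X by (auto simp: response_def fun_eq_iff)
    have "0\<^sub>v ?n \<in> admissible_effects v1 v2"
      by (simp add: admissible_effects_def mult_add_less_mult)
    then have "w \<bullet> w = w \<bullet> 0\<^sub>v ?n"
      using assms(5)[OF ij] w(5) same unfolding estimable_def X_def[symmetric] w_def[symmetric]
      by metis
    then show False using w(1,2) by simp
  qed
  have balanced: "eigenvector (information_matrix X) w \<alpha> \<and>
      w \<bullet> (moore_penrose (information_matrix X) *\<^sub>v w) * \<sigma>\<^sup>2 = 1 / \<alpha> * \<sigma>\<^sup>2 \<and>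
      (\<forall>\<tau> \<in> admissible_effects v1 v2.
         prob_space.variance M (\<lambda>\<omega>. w \<bullet> effects_estimator X (response X \<epsilon> \<tau> \<omega>)) = 1 / \<alpha> * \<sigma>\<^sup>2)"
    if ij: "i < v1 - 1" "j < v2 - 1" and w_def: "w = p i \<otimes>\<^sub>v q j" for i j w
  proof (intro conjI ballI)
    note w = contrast[OF ij w_def]
    note \<alpha> = nonzero[OF ij]
    show "eigenvector (information_matrix X) w \<alpha>"
      using w X by (auto simp: eigenvector_def information_matrix_def)
    show "w \<bullet> (moore_penrose (information_matrix X) *\<^sub>v w) * \<sigma>\<^sup>2 = 1 / \<alpha> * \<sigma>\<^sup>2"
      using w by (simp add: MP field_simps)
    fix \<tau> assume "\<tau> \<in> admissible_effects v1 v2"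
    then have \<tau>: "\<tau> \<in> carrier_vec ?n" by (simp add: admissible_effects_def)
    \<comment> \<open>The coefficient vector of the estimator as a linear function of the response:
      symmetry of \<open>G\<close> moves it onto \<open>w\<close>, where it acts as
      \<open>inverse \<alpha>\<close>, and the transpose of \<open>X\<close> moves across as
      \<open>X\<close>.\<close>
    define b where "b = inverse \<alpha> \<cdot>\<^sub>v (X *\<^sub>v w)"
    have b: "b \<in> carrier_vec N" using X w(1) by (auto simp: b_def)
    have est: "w \<bullet> effects_estimator X y = b \<bullet> y" if y: "y \<in> carrier_vec N" for y
    proof -
      have Xy: "transpose_mat X *\<^sub>v y \<in> carrier_vec ?n" using X y by auto
      have "w \<bullet> (G *\<^sub>v (transpose_mat X *\<^sub>v y)) = (G *\<^sub>v w) \<bullet> (transpose_mat X *\<^sub>v y)"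
        using transpose_vec_mult_scalar[OF G Xy w(1)] by (simp add: G_def)
      also have "\<dots> = inverse \<alpha> * (w \<bullet> (transpose_mat X *\<^sub>v y))"
        using w Xy by simp
      also have "w \<bullet> (transpose_mat X *\<^sub>v y) = (X *\<^sub>v w) \<bullet> y"
        using transpose_vec_mult_scalar[OF _ y w(1), of "transpose_mat X"] X by simp
      finally show ?thesis using X y w(1) by (simp add: effects_estimator_def MP b_def)
    qed
    have "w \<bullet> effects_estimator X (response X \<epsilon> \<tau> \<omega>)
        = b \<bullet> (X *\<^sub>v \<tau>) + (\<Sum>k<N. b $ k * \<epsilon> k \<omega>)" for \<omega>
    proof -
      have "w \<bullet> effects_estimator X (response X \<epsilon> \<tau> \<omega>)
          = b \<bullet> (X *\<^sub>v \<tau> + Matrix.vec N (\<lambda>k. \<epsilon> k \<omega>))"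
        using est X \<tau> by (auto simp: response_def)
      also have "\<dots> = b \<bullet> (X *\<^sub>v \<tau>) + b \<bullet> Matrix.vec N (\<lambda>k. \<epsilon> k \<omega>)"
        by (rule scalar_prod_add_distrib[OF b]) (use X \<tau> in auto)
      finally show ?thesis by (simp add: scalar_prod_def atLeast0LessThan)
    qed
    then have "prob_space.variance M (\<lambda>\<omega>. w \<bullet> effects_estimator X (response X \<epsilon> \<tau> \<omega>))
        = (\<Sum>k<N. b $ k * b $ k) * \<sigma>\<^sup>2"
      using normal_errors_variance[OF assms(2)] by simp
    also have "(\<Sum>k<N. b $ k * b $ k) = b \<bullet> b"
      using b by (simp add: scalar_prod_def atLeast0LessThan)
    \<comment> \<open>The squared length of \<open>X *\<^sub>v w\<close> is \<open>\<alpha>\<close>,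
      so one of the two factors \<open>inverse \<alpha>\<close> cancels.\<close>
    also have "b \<bullet> b = 1 / \<alpha>"
      using X w(1,6) \<alpha> by (simp add: b_def inverse_eq_divide)
    finally show "prob_space.variance M (\<lambda>\<omega>. w \<bullet> effects_estimator X (response X \<epsilon> \<tau> \<omega>))
        = 1 / \<alpha> * \<sigma>\<^sup>2" .
  qed
  show ?thesis
  proof (cases "v1 - 1 = 0 \<or> v2 - 1 = 0")
    case True
    \<comment> \<open>There are no basic contrasts here, so \<open>\<alpha>\<close> could vanish;
      any nonzero witness serves.\<close>
    then show ?thesis unfolding variance_balanced_def by (intro exI[of _ 1]) auto
  next
    case False
    then have "\<alpha> \<noteq> 0" using nonzero by blast
    then show ?thesis
      using balanced unfolding variance_balanced_def X_def[symmetric] by blast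
  qed
qed

end
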